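(* Let $T,d_w\ge1$ be integers and let $w_1,\dots,w_T\in\mathbb{R}^{d_w}$ be fixed known vectors. Let $Y=(Y_1,\dots,Y_T)'\in\{0,1\}^T$ be a random vector of outcomes following, given initial conditions $Y^0$, covariates $X=(X_1,\dots,X_T)$ and fixed effect $A\in\mathbb{R}^{d_w}$, the model $$\Pr(Y=y\mid Y^0,X,A)=\prod_{t=1}^T\frac{\left[\exp\left(\pi_t(y^{t-1},X_t,\theta)+w_t'A\right)\right]^{y_t}}{1+\exp\left(\pi_t(y^{t-1},X_t,\theta)+w_t'A\right)},\qquad y\in\{0,1\}^T,$$ where $y^{t-1}=(y_{t-1},y_{t-2},\dots,y_1,Y^0)$, $\theta$ is a parameter, and each $\pi_t(\cdot,\cdot,\cdot)$ is a known real-valued function. Let $Y^0$, $X$, $\theta$ be given (fixed) values. For $t\in\{1,\dots,T\}$ let $Q_t$ be the number of elements of the set $$\Pi_t=\left\{\pi_t\big((y_{t-1},y_{t-2},\dots,y_1,Y^0),X_t,\theta\big)\;:\;(y_{t-1},\dots,y_1)\in\{0,1\}^{t-1}\right\},$$ and let $$\mathcal{D}=\left\{\sum_{t=1}^T k_t w_t\;:\;(k_1,\dots,k_T)\in\prod_{t=1}^T\{0,1,\dots,Q_t\}\right\}\subset\mathbb{R}^{d_w}.$$ Then the number of linearly independent fixed-effect-free moment functions, i.e. of linearly independent functions $m(\cdot,Y^0,X,\theta):\{0,1\}^T\to\mathbb{R}$ satisfying $$\mathbb{E}\left[m(Y,Y^0,X,\theta)\mid Y^0,X,A\right]=0\quad\text{for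 all values of }A\in\mathbb{R}^{d_w},$$ is at least $2^T-|\mathcal{D}|$. In particular, if $|\mathcal{D}|<2^T$, then non-zero moment functions of this form exist.
   Context: Here, for fixed $Y^0,X,\theta$, a moment function is viewed as an element of the $2^T$-dimensional real vector space of functions of $y\in\{0,1\}^T$, and the condition reads $\sum_{y\in\{0,1\}^T}m(y,Y^0,X,\theta)\Pr(Y=y\mid Y^0,X,A=a)=0$ for every $a\in\mathbb{R}^{d_w}$. $|\cdot|$ denotes cardinality. For $t=1$, $\Pi_1=\{\pi_1(Y^0,X_1,\theta)\}$, so $Q_1=1$. *)

theory Defs
  imports "HOL-Analysis.Analysis" "HOL-Library.Function_Algebras"
begin

text \<open>Real-valued functions as a real vector space, with pointwise operations
  (addition comes from \<^theory>\<open>HOL-Library.Function_Algebras\<close>).\<close>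

instantiation "fun" :: (type, real_vector) real_vector
begin

definition scaleR_fun :: "real \<Rightarrow> ('a \<Rightarrow> 'b) \<Rightarrow> 'a \<Rightarrow> 'b" where
  "scaleR_fun c f = (\<lambda>x. c *\<^sub>R f x)"

instance
  by standard (simp_all add: scaleR_fun_def fun_eq_iff scaleR_add_right scaleR_add_left)

end

text \<open>An outcome vector \<open>(y\<^sub>1, \<dots>, y\<^sub>T)\<close> is an extensional function on \<open>{1..T}\<close>.\<close>

definition outcomes :: "nat \<Rightarrow> (nat \<Rightarrow> nat) set" where
  "outcomes T = {1..T} \<rightarrow>\<^sub>E {0, 1}"

text \<open>\<open>history y Y0 t\<close> is \<open>(y\<^sub>t\<^sub>-\<^sub>1, \<dots>, y\<^sub>1, Y\<^sup>0)\<close>, most recent outcome first.\<close>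

definition history :: "(nat \<Rightarrow> nat) \<Rightarrow> 'i \<Rightarrow> nat \<Rightarrow> nat list \<times> 'i" where
  "history y Y0 t = (rev (map y [1..<t]), Y0)"

type_synonym ('i, 'x, 'p) index_function = "nat \<Rightarrow> nat list \<times> 'i \<Rightarrow> 'x \<Rightarrow> 'p \<Rightarrow> real"

text \<open>\<open>Pr(Y = y | Y\<^sup>0, X, A = a)\<close>\<close>

definition outcome_prob ::
  "nat \<Rightarrow> (nat \<Rightarrow> real ^ 'd) \<Rightarrow> ('i, 'x, 'p) index_function \<Rightarrow> 'i \<Rightarrow> (nat \<Rightarrow> 'x) \<Rightarrow> 'p
    \<Rightarrow> real ^ 'd \<Rightarrow> (nat \<Rightarrow> nat) \<Rightarrow> real" where
  "outcome_prob T w \<pi> Y0 X \<theta> a y =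
    (\<Prod>t=1..T. exp (\<pi> t (history y Y0 t) (X t) \<theta> + w t \<bullet> a) ^ y t
               / (1 + exp (\<pi> t (history y Y0 t) (X t) \<theta> + w t \<bullet> a)))"

definition outcome_expectation ::
  "nat \<Rightarrow> (nat \<Rightarrow> real ^ 'd) \<Rightarrow> ('i, 'x, 'p) index_function \<Rightarrow> 'i \<Rightarrow> (nat \<Rightarrow> 'x) \<Rightarrow> 'p
    \<Rightarrow> real ^ 'd \<Rightarrow> ((nat \<Rightarrow> nat) \<Rightarrow> real) \<Rightarrow> real" where
  "outcome_expectation T w \<pi> Y0 X \<theta> a m =
    (\<Sum>y\<in>outcomes T. m y * outcome_prob T w \<pi> Y0 X \<theta> a y)"

text \<open>A function on \<open>{0,1}\<^sup>T\<close> is represented by its extension by zero, so that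
  the functions on \<open>{0,1}\<^sup>T\<close> form a subspace of dimension \<open>2\<^sup>T\<close>.\<close>

definition moment_functions ::
  "nat \<Rightarrow> (nat \<Rightarrow> real ^ 'd) \<Rightarrow> ('i, 'x, 'p) index_function \<Rightarrow> 'i \<Rightarrow> (nat \<Rightarrow> 'x) \<Rightarrow> 'p
    \<Rightarrow> ((nat \<Rightarrow> nat) \<Rightarrow> real) set" where
  "moment_functions T w \<pi> Y0 X \<theta> =
    {m. (\<forall>y. y \<notin> outcomes T \<longrightarrow> m y = 0) \<and>
        (\<forall>a. outcome_expectation T w \<pi> Y0 X \<theta> a m = 0)}"

definition index_values ::
  "('i, 'x, 'p) index_function \<Rightarrow> 'i \<Rightarrow> (nat \<Rightarrow> 'x) \<Rightarrow> 'p \<Rightarrow> nat \<Rightarrow> real set" where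
  "index_values \<pi> Y0 X \<theta> t =
    {\<pi> t (ys, Y0) (X t) \<theta> | ys. length ys = t - 1 \<and> set ys \<subseteq> {0, 1}}"

definition weight_sums ::
  "nat \<Rightarrow> (nat \<Rightarrow> real ^ 'd) \<Rightarrow> (nat \<Rightarrow> nat) \<Rightarrow> (real ^ 'd) set" where
  "weight_sums T w Q =
    {(\<Sum>t=1..T. real (k t) *\<^sub>R w t) | k. k \<in> (\<Pi>\<^sub>E t\<in>{1..T}. {0..Q t})}"

end

theory Submission
  imports Defs "HOL-Computational_Algebra.Polynomial"
begin

text \<open>Multiplying \<open>Pr(Y = y | A = a)\<close> by the positive factor
  \<open>\<Prod>\<^sub>t (\<Prod>q\<in>\<Pi>\<^sub>t. 1 + exp (q + w\<^sub>t \<bullet> a))\<close>, which does not depend on \<open>y\<close>, turns it into a product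
  over \<open>t\<close> of polynomials of degree at most \<open>Q\<^sub>t\<close> in \<open>exp (w\<^sub>t \<bullet> a)\<close>, hence into a linear
  combination of the functions \<open>a \<mapsto> exp (d \<bullet> a)\<close> with \<open>d \<in> D\<close>. It therefore suffices that
  \<open>m\<close> satisfies one linear equation for each \<open>d \<in> D\<close>.\<close>

section \<open>Dimension counts for subspaces cut out by linear equations\<close>

text \<open>One equation costs at most one dimension: a basis \<open>C\<close> of the kernel
  together with a single vector outside it spans \<open>S\<close>. The finite spanning set
  \<open>F\<close> makes \<open>C\<close> finite, so that the exchange bound applies.\<close>

lemma dim_le_Suc_dim_kernel:
  fixes S :: "'a::real_vector set" and f :: "'a \<Rightarrow> real"
  assumes S: "subspace S" and F: "finite F" "S \<subseteq> span F" and f: "linear f"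
  shows "dim S \<le> Suc (dim {x\<in>S. f x = 0})"
proof -
  obtain B where B: "B \<subseteq> S" "independent B" "S \<subseteq> span B"
    using real_vector.maximal_independent_subset by blast
  obtain C where C: "C \<subseteq> {x\<in>S. f x = 0}" "independent C" "{x\<in>S. f x = 0} \<subseteq> span C"
    using real_vector.maximal_independent_subset by blast
  have "C \<subseteq> span F"
    using C(1) F(2) by auto
  then have finC: "finite C"
    using real_vector.independent_span_bound[OF F(1) C(2)] by blast
  obtain b where b: "S \<subseteq> span (insert b C)"
  proof (cases "\<exists>b\<in>S. f b \<noteq> 0")
    case True
    then obtain b where b: "b \<in> S" "f b \<noteq> 0" by blast
    have "x \<in> span (insert b C)" if "x \<in> S" for x
    proof -
      \<comment> \<open>The multiple of \<open>b\<close> is chosen so that \<open>f\<close> vanishes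
        on the difference.\<close>
      let ?z = "x - (f x / f b) *\<^sub>R b"
      have "?z \<in> S"
        using S that b(1) by (intro subspace_diff subspace_scale)
      moreover have "f ?z = 0"
        using b(2) by (simp add: linear_diff[OF f] linear_scale[OF f])
      ultimately have "?z \<in> span C"
        using C(3) by blast
      then show ?thesis
        by (auto simp: span_insert)
    qed
    then show ?thesis
      using that by blast
  next
    case False
    then have "S \<subseteq> span C"
      using C(3) by blast
    then show ?thesis
      \<comment> \<open>If \<open>f\<close> vanishes on \<open>S\<close>, then \<open>C\<close>
        alone spans \<open>S\<close>, and \<open>0\<close> is a harmless filler for
        \<open>b\<close>.\<close>
      using that[of 0] span_mono[of C "insert 0 C"] by blast
  qed
  have "card B \<le> card (insert b C)"
    using real_vector.independent_span_bound[of "insert b C" B] finC B(1,2) b by auto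
  also have "\<dots> \<le> Suc (card C)"
    by (rule card_insert_le_m1) auto
  finally show ?thesis
    using real_vector.basis_card_eq_dim[OF B(1,3,2)] real_vector.basis_card_eq_dim[OF C(1,3,2)]
    by simp
qed

lemma dim_le_dim_common_kernel:
  fixes S :: "'a::real_vector set" and f :: "'b \<Rightarrow> 'a \<Rightarrow> real"
  assumes S: "subspace S" and F: "finite F" "S \<subseteq> span F"
    and D: "finite D" and f: "\<And>d. d \<in> D \<Longrightarrow> linear (f d)"
  shows "dim S \<le> dim {x\<in>S. \<forall>d\<in>D. f d x = 0} + card D"
  using D f
proof (induction D rule: finite_induct)
  case empty
  then show ?case by simp
next
  case (insert e D)
  let ?K = "{x\<in>S. \<forall>d\<in>D. f d x = 0}"
  have "subspace ?K"
    using S insert.prems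
    by (auto simp: subspace_def linear_add linear_scale linear_0)
  then have "dim ?K \<le> Suc (dim {x\<in>?K. f e x = 0})"
    using F insert.prems by (intro dim_le_Suc_dim_kernel) auto
  moreover have "{x\<in>?K. f e x = 0} = {x\<in>S. \<forall>d\<in>insert e D. f d x = 0}"
    by auto
  moreover have "dim S \<le> dim ?K + card D"
    using insert by auto
  ultimately show ?case
    using insert.hyps by simp
qed

lemma subspace_supported_functions:
  "subspace {m :: 'a \<Rightarrow> real. \<forall>y. y \<notin> A \<longrightarrow> m y = 0}"
  by (auto simp: subspace_def scaleR_fun_def)

text \<open>The point indicators of \<open>A\<close> form such a basis; the induction adds one
  indicator per point.\<close>

lemma supported_functions_basis:
  assumes "finite A"
  shows "\<exists>B. finite B \<and> card B = card A \<and> independent B \<and>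
             span B = {m :: 'a \<Rightarrow> real. \<forall>y. y \<notin> A \<longrightarrow> m y = 0}"
  using assms
proof (induction A rule: finite_induct)
  case empty
  have "{m :: 'a \<Rightarrow> real. \<forall>y. m y = 0} = {0}"
    by (auto simp: fun_eq_iff)
  then show ?case
    by (intro exI[of _ "{}"]) (simp add: real_vector.independent_empty)
next
  case (insert x A)
  then obtain B where B: "finite B" "card B = card A" "independent B"
    "span B = {m :: 'a \<Rightarrow> real. \<forall>y. y \<notin> A \<longrightarrow> m y = 0}" by blast
  define e :: "'a \<Rightarrow> real" where "e = (\<lambda>y. if y = x then 1 else 0)"
  have e: "e \<notin> span B"
    using insert.hyps by (auto simp: B(4) e_def)
  then have "e \<notin> B"
    using span_base by blast
  have "m \<in> span (insert e B) \<longleftrightarrow> (\<forall>y. y \<notin> insert x A \<longrightarrow> m y = 0)" for m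
  proof
    assume "m \<in> span (insert e B)"
    then obtain k where "m - k *\<^sub>R e \<in> span B"
      by (auto simp: span_insert)
    then show "\<forall>y. y \<notin> insert x A \<longrightarrow> m y = 0"
      by (auto simp: B(4) e_def scaleR_fun_def)
  next
    assume "\<forall>y. y \<notin> insert x A \<longrightarrow> m y = 0"
    \<comment> \<open>Subtracting \<open>m x\<close> times the indicator of \<open>x\<close> kills
      the value at \<open>x\<close>, so the difference is supported in \<open>A\<close>.\<close>
    then have "m - m x *\<^sub>R e \<in> span B"
      by (auto simp: B(4) e_def scaleR_fun_def)
    then show "m \<in> span (insert e B)"
      by (auto simp: span_insert)
  qed
  then show ?case
    using B(1-3) independent_insertI[OF e B(3)] \<open>e \<notin> B\<close> insert.hyps
    by (intro exI[of _ "insert e B"]) (auto simp del: insert_iff)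
qed

text \<open>Monotonicity needs care here because \<open>dim\<close> is \<open>0\<close> on
  infinite-dimensional sets, and the ambient function space need not be finite-dimensional. The
  finite span of \<open>M\<close> rules this out.\<close>

lemma dim_mono_finite_span:
  fixes K M :: "'a::real_vector set"
  assumes "K \<subseteq> M" "finite F" "M \<subseteq> span F"
  shows "dim K \<le> dim M"
proof -
  obtain B where B: "B \<subseteq> K" "independent B" "K \<subseteq> span B"
    using real_vector.maximal_independent_subset by blast
  obtain C where C: "C \<subseteq> M" "independent C" "M \<subseteq> span C"
    using real_vector.maximal_independent_subset by blast
  have "finite C"
    using real_vector.independent_span_bound[OF assms(2) C(2)] C(1) assms(3) by blast
  then have "card B \<le> card C"
    using real_vector.independent_span_bound[of C B] B(1,2) C(3) assms(1) by blast
  then show ?thesis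
    using real_vector.basis_card_eq_dim[OF B(1,3,2)] real_vector.basis_card_eq_dim[OF C(1,3,2)]
    by simp
qed

section \<open>Finiteness and the attainable index values\<close>

lemma weight_sums_eq_image:
  "weight_sums T w Q = (\<lambda>k. \<Sum>t=1..T. real (k t) *\<^sub>R w t) ` (\<Pi>\<^sub>E t\<in>{1..T}. {0..Q t})"
  by (auto simp: weight_sums_def)

lemma finite_weight_sums: "finite (weight_sums T w Q)"
  by (simp add: weight_sums_eq_image finite_PiE)

lemma finite_outcomes: "finite (outcomes T)"
  by (simp add: outcomes_def finite_PiE)

lemma card_outcomes: "card (outcomes T) = 2 ^ T"
  by (simp add: outcomes_def card_PiE numeral_2_eq_2)

lemma finite_index_values: "finite (index_values \<pi> Y0 X \<theta> t)"
proof -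
  have "index_values \<pi> Y0 X \<theta> t =
      (\<lambda>ys. \<pi> t (ys, Y0) (X t) \<theta>) ` {ys. set ys \<subseteq> {0, 1} \<and> length ys = t - 1}"
    by (auto simp: index_values_def)
  then show ?thesis
    by (simp add: finite_lists_length_eq)
qed

text \<open>This places the denominator that \<open>y\<close> produces in period \<open>t\<close>
  among the factors of the common denominator.\<close>

lemma history_index_in_index_values:
  assumes "y \<in> outcomes T" "t \<in> {1..T}"
  shows "\<pi> t (history y Y0 t) (X t) \<theta> \<in> index_values \<pi> Y0 X \<theta> t"
proof -
  have "y ` {1..<t} \<subseteq> {0, 1}"
    using assms by (auto simp: outcomes_def dest!: PiE_mem)
  then have "length (rev (map y [1..<t])) = t - 1 \<and> set (rev (map y [1..<t])) \<subseteq> {0, 1}"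
    by simp
  then show ?thesis
    unfolding index_values_def history_def by blast
qed

section \<open>Expansion into exponentials\<close>

text \<open>Expanding the product picks a degree \<open>k t\<close> in each factor, and the chosen
  powers combine to one exponential with exponent vector \<open>\<Sum>t. k t * w t\<close>. The
  coefficients \<open>c\<close> do not depend on \<open>a\<close>.\<close>

lemma prod_poly_exp_expansion:
  fixes w :: "nat \<Rightarrow> real ^ 'd"
  assumes "\<And>t. t \<in> {1..T} \<Longrightarrow> degree (p t) \<le> Q t"
  shows "\<exists>c. \<forall>a. (\<Prod>t=1..T. poly (p t) (exp (w t \<bullet> a))) =
                  (\<Sum>d\<in>weight_sums T w Q. c d * exp (d \<bullet> a))"
proof -
  let ?P = "\<Pi>\<^sub>E t\<in>{1..T}. {0..Q t}"
  let ?g = "\<lambda>k. \<Sum>t=1..T. real (k t) *\<^sub>R w t"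
  let ?c = "\<lambda>k. \<Prod>t=1..T. coeff (p t) (k t)"
  have fin: "finite ?P"
    by (simp add: finite_PiE)
  have "(\<Prod>t=1..T. poly (p t) (exp (w t \<bullet> a))) =
      (\<Sum>d\<in>weight_sums T w Q. (\<Sum>k | k \<in> ?P \<and> ?g k = d. ?c k) * exp (d \<bullet> a))" for a
  proof -
    have "(\<Prod>t=1..T. poly (p t) (exp (w t \<bullet> a))) =
        (\<Prod>t=1..T. \<Sum>i\<in>{0..Q t}. coeff (p t) i * exp (w t \<bullet> a) ^ i)"
    proof (intro prod.cong refl)
      fix t assume "t \<in> {1..T}"
      \<comment> \<open>Padding with zero coefficients gives every factor the index range
        \<open>{0..Q t}\<close>.\<close>
      then have "{..degree (p t)} \<subseteq> {0..Q t}"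
        using assms by fastforce
      then show "poly (p t) (exp (w t \<bullet> a)) =
          (\<Sum>i\<in>{0..Q t}. coeff (p t) i * exp (w t \<bullet> a) ^ i)"
        unfolding poly_altdef by (intro sum.mono_neutral_left) (auto simp: coeff_eq_0)
    qed
    also have "\<dots> = (\<Sum>k\<in>?P. \<Prod>t=1..T. coeff (p t) (k t) * exp (w t \<bullet> a) ^ k t)"
      by (rule prod_sum_PiE) auto
    also have "\<dots> = (\<Sum>k\<in>?P. ?c k * exp (?g k \<bullet> a))"
      by (simp add: prod.distrib inner_sum_left exp_sum exp_of_nat_mult)
    \<comment> \<open>Different \<open>k\<close> may give the same vector \<open>d\<close>;
      collecting them leaves one term per element of \<open>weight_sums T w Q\<close>.\<close>
    also have "\<dots> = (\<Sum>d\<in>?g ` ?P. \<Sum>k | k \<in> ?P \<and> ?g k = d. ?c k * exp (?g k \<bullet> a))"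
      by (rule sum.image_gen[OF fin])
    also have "\<dots> = (\<Sum>d\<in>?g ` ?P. (\<Sum>k | k \<in> ?P \<and> ?g k = d. ?c k) * exp (d \<bullet> a))"
      by (simp add: sum_distrib_right)
    finally show ?thesis
      by (simp add: weight_sums_eq_image)
  qed
  then show ?thesis
    by (intro exI allI)
qed

text \<open>The inner product runs over distinct index values, not over histories, so period
  \<open>t\<close> contributes exactly \<open>Q t\<close> linear factors.\<close>

definition common_denominator ::
  "nat \<Rightarrow> (nat \<Rightarrow> real ^ 'd) \<Rightarrow> ('i, 'x, 'p) index_function \<Rightarrow> 'i \<Rightarrow> (nat \<Rightarrow> 'x) \<Rightarrow> 'p
    \<Rightarrow> real ^ 'd \<Rightarrow> real" where
  "common_denominator T w \<pi> Y0 X \<theta> a =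
    (\<Prod>t=1..T. \<Prod>q\<in>index_values \<pi> Y0 X \<theta> t. 1 + exp (q + w t \<bullet> a))"

lemma common_denominator_pos: "common_denominator T w \<pi> Y0 X \<theta> a > 0"
  unfolding common_denominator_def by (intro prod_pos) (auto intro: add_pos_pos)

lemma outcome_prob_exp_expansion:
  fixes w :: "nat \<Rightarrow> real ^ 'd"
  assumes y: "y \<in> outcomes T"
  shows "\<exists>c. \<forall>a. outcome_prob T w \<pi> Y0 X \<theta> a y * common_denominator T w \<pi> Y0 X \<theta> a =
    (\<Sum>d\<in>weight_sums T w (\<lambda>t. card (index_values \<pi> Y0 X \<theta> t)). c d * exp (d \<bullet> a))"
proof -
  let ?I = "index_values \<pi> Y0 X \<theta>"
  define r where "r t = \<pi> t (history y Y0 t) (X t) \<theta>" for t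
  \<comment> \<open>With \<open>z = exp (w t \<bullet> a)\<close>, each
    \<open>1 + exp (q + w t \<bullet> a)\<close> is \<open>[:1, exp q:]\<close> at \<open>z\<close>.
    The factor for \<open>r t\<close> is missing because it cancels the denominator in the
    probability.\<close>
  define p where "p t = monom (exp (r t) ^ y t) (y t) * (\<Prod>q\<in>?I t - {r t}. [:1, exp q:])" for t
  have r: "r t \<in> ?I t" if "t \<in> {1..T}" for t
    using history_index_in_index_values[OF y that] by (simp add: r_def)
  have deg: "degree (p t) \<le> card (?I t)" if t: "t \<in> {1..T}" for t
  proof -
    have "y t \<le> 1"
      using y t by (auto simp: outcomes_def dest: PiE_mem)
    have "degree (\<Prod>q\<in>?I t - {r t}. [:1, exp q:]) \<le> (\<Sum>q\<in>?I t - {r t}. degree [:1, exp q:])"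
      using degree_prod_sum_le[of "?I t - {r t}" "\<lambda>q. [:1, exp q:]"] finite_index_values[of \<pi> Y0 X \<theta> t]
      by (simp only: o_def finite_Diff)
    also have "\<dots> = card (?I t) - 1"
      using r[OF t] finite_index_values by simp
    finally have "degree (\<Prod>q\<in>?I t - {r t}. [:1, exp q:]) \<le> card (?I t) - 1" .
    \<comment> \<open>Needed as the subtraction is truncated: the cancelled factor makes room for
      the degree \<open>y t \<le> 1\<close> of the numerator.\<close>
    moreover have "card (?I t) \<ge> 1"
      using r[OF t] finite_index_values[of \<pi> Y0 X \<theta> t]
      by (metis One_nat_def Suc_leI card_gt_0_iff empty_iff)
    moreover have "degree (p t) \<le> y t + degree (\<Prod>q\<in>?I t - {r t}. [:1, exp q:])"
      unfolding p_def by (rule order_trans[OF degree_mult_le]) (simp add: degree_monom_le)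
    ultimately show ?thesis
      using \<open>y t \<le> 1\<close> by linarith
  qed
  have "outcome_prob T w \<pi> Y0 X \<theta> a y * common_denominator T w \<pi> Y0 X \<theta> a =
      (\<Prod>t=1..T. poly (p t) (exp (w t \<bullet> a)))" for a
    unfolding outcome_prob_def common_denominator_def prod.distrib[symmetric]
  proof (intro prod.cong refl)
    fix t assume t: "t \<in> {1..T}"
    have "(1::real) + exp (r t + w t \<bullet> a) \<noteq> 0"
      by (smt (verit) exp_gt_zero)
    moreover have "(\<Prod>q\<in>?I t. 1 + exp (q + w t \<bullet> a)) =
        (1 + exp (r t + w t \<bullet> a)) * (\<Prod>q\<in>?I t - {r t}. 1 + exp (q + w t \<bullet> a))"
      using r[OF t] finite_index_values by (intro prod.remove)
    moreover have "poly (p t) (exp (w t \<bullet> a)) =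
        exp (r t + w t \<bullet> a) ^ y t * (\<Prod>q\<in>?I t - {r t}. 1 + exp (q + w t \<bullet> a))"
      by (simp add: p_def poly_monom poly_prod exp_add power_mult_distrib mult.commute)
    ultimately show "exp (\<pi> t (history y Y0 t) (X t) \<theta> + w t \<bullet> a) ^ y t
        / (1 + exp (\<pi> t (history y Y0 t) (X t) \<theta> + w t \<bullet> a))
        * (\<Prod>q\<in>?I t. 1 + exp (q + w t \<bullet> a)) = poly (p t) (exp (w t \<bullet> a))"
      by (simp flip: r_def)
  qed
  then show ?thesis
    using prod_poly_exp_expansion[of T p "\<lambda>t. card (?I t)" w] deg by simp
qed

section \<open>Counting the moment functions\<close>

theorem theorem3:
  fixes T :: nat
    and w :: "nat \<Rightarrow> real ^ 'd"
    and \<pi> :: "('i, 'x, 'p) index_function"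
    and Y0 :: 'i and X :: "nat \<Rightarrow> 'x" and \<theta> :: 'p
  assumes "T \<ge> 1"
  shows "let Q = (\<lambda>t. card (index_values \<pi> Y0 X \<theta> t));
             D = weight_sums T w Q;
             M = moment_functions T w \<pi> Y0 X \<theta>
         in int (dim M) \<ge> 2 ^ T - int (card D) \<and>
            (card D < 2 ^ T \<longrightarrow> (\<exists>m\<in>M. m \<noteq> 0))"
proof -
  define D where "D = weight_sums T w (\<lambda>t. card (index_values \<pi> Y0 X \<theta> t))"
  define M where "M = moment_functions T w \<pi> Y0 X \<theta>"
  define S where "S = {m :: (nat \<Rightarrow> nat) \<Rightarrow> real. \<forall>y. y \<notin> outcomes T \<longrightarrow> m y = 0}"
  obtain B where B: "finite B" "card B = 2 ^ T" "independent B" "span B = S"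
    using supported_functions_basis[OF finite_outcomes[of T]]
    by (auto simp: card_outcomes S_def)
  obtain c where c: "\<And>y a. y \<in> outcomes T \<Longrightarrow>
      outcome_prob T w \<pi> Y0 X \<theta> a y * common_denominator T w \<pi> Y0 X \<theta> a =
      (\<Sum>d\<in>D. c y d * exp (d \<bullet> a))"
    using outcome_prob_exp_expansion[of _ T w \<pi> Y0 X \<theta>] unfolding D_def by metis
  \<comment> \<open>\<open>f d m\<close> is the coefficient of \<open>exp (d \<bullet> a)\<close> in
    the expectation of \<open>m\<close> times the common denominator.\<close>
  define f where "f d m = (\<Sum>y\<in>outcomes T. m y * c y d)" for d and m :: "(nat \<Rightarrow> nat) \<Rightarrow> real"
  define K where "K = {m\<in>S. \<forall>d\<in>D. f d m = 0}"
  have "linear (f d)" for d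
    by (rule linearI)
      (simp_all add: f_def scaleR_fun_def sum.distrib sum_distrib_left distrib_right mult.assoc)
  then have "dim S \<le> dim K + card D"
    unfolding K_def using B finite_weight_sums subspace_supported_functions
    by (intro dim_le_dim_common_kernel[of S B D f]) (auto simp: D_def S_def)
  moreover have "dim S = 2 ^ T"
    using real_vector.basis_card_eq_dim[of B S] B span_superset[of B] by simp
  \<comment> \<open>If all these coefficients vanish, so does the scaled expectation for every
    \<open>a\<close>, and the positive scale can be divided out.\<close>
  moreover have "K \<subseteq> M"
  proof
    fix m assume m: "m \<in> K"
    have "outcome_expectation T w \<pi> Y0 X \<theta> a m = 0" for a
    proof -
      have "outcome_expectation T w \<pi> Y0 X \<theta> a m * common_denominator T w \<pi> Y0 X \<theta> a =
          (\<Sum>y\<in>outcomes T. m y * (\<Sum>d\<in>D. c y d * exp (d \<bullet> a)))"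
        by (simp add: outcome_expectation_def sum_distrib_right mult.assoc c)
      also have "\<dots> = (\<Sum>y\<in>outcomes T. \<Sum>d\<in>D. m y * c y d * exp (d \<bullet> a))"
        by (simp add: sum_distrib_left mult.assoc)
      also have "\<dots> = (\<Sum>d\<in>D. f d m * exp (d \<bullet> a))"
        by (subst sum.swap) (simp add: f_def sum_distrib_right)
      also have "\<dots> = 0"
        using m by (simp add: K_def)
      finally show ?thesis
        using common_denominator_pos[of T w \<pi> Y0 X \<theta> a] by simp
    qed
    then show "m \<in> M"
      using m by (simp add: K_def S_def M_def moment_functions_def)
  qed
  moreover have "M \<subseteq> span B"
    by (auto simp: B(4) S_def M_def moment_functions_def)
  ultimately have *: "2 ^ T \<le> dim M + card D"
    using dim_mono_finite_span[of K M B] B(1) by linarith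
  have "\<exists>m\<in>M. m \<noteq> 0" if "card D < 2 ^ T"
  proof (rule ccontr)
    assume "\<not> ?thesis"
    then have "M \<subseteq> span {}" by auto
    then have "dim M = 0"
      using real_vector.basis_card_eq_dim[of "{}" M] real_vector.independent_empty by simp
    then show False
      using * that by simp
  qed
  \<comment> \<open>Over the integers the lower bound may be negative.\<close>
  moreover have "int (dim M) \<ge> 2 ^ T - int (card D)"
    using of_nat_mono[OF *, where 'a = int] by simp
  ultimately show ?thesis
    by (simp add: Let_def D_def M_def)
qed

end
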